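(* There exists a universal constant $C > 0$ such that for all positive integers $m$ and $n$, and all matrices $A \in \mathbb{R}^{m\times n}$, $$\mathrm{herdisc}(A) \le C\sqrt{n}\cdot \mathrm{detlb}(A).$$
   Context: For a real $m\times n$ matrix $A$, the discrepancy is $\mathrm{disc}(A) = \min_{x\in\{\pm1\}^n}\|Ax\|_\infty$. The hereditary discrepancy $\mathrm{herdisc}(A)$ is the maximum of $\mathrm{disc}(B)$ over all submatrices $B$ of $A$ (equivalently, over all submatrices consisting of a nonempty subset of the columns of $A$). The determinant lower bound is $\mathrm{detlb}(A) = \max_{k}\max_{B}|\det(B)|^{1/k}$, where $k$ ranges over $1\le k\le \min(m,n)$ and $B$ over all $k\times k$ submatrices of $A$ (any $k$ rows and any $k$ columns). *)

theory Defs
  imports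
    Complex_Main
    "Jordan_Normal_Form.Determinant"
    "Jordan_Normal_Form.DL_Submatrix"
begin

text \<open>
  Matrices are the carrier-based ones of \<^theory>\<open>Jordan_Normal_Form.Matrix\<close>, with rows and columns
  indexed from \<open>0\<close>.  All maxima and minima below range over finite sets that are nonempty
  whenever the matrix has at least one row and one column; they have no meaning otherwise.
\<close>

definition linf_norm :: "real vec \<Rightarrow> real" where
  "linf_norm v = (MAX i\<in>{..<dim_vec v}. \<bar>v $ i\<bar>)"

definition sign_vecs :: "nat \<Rightarrow> real vec set" where
  "sign_vecs n = {x \<in> carrier_vec n. \<forall>i<n. x $ i \<in> {-1, 1}}"

definition disc :: "real mat \<Rightarrow> real" where
  "disc A = (MIN x\<in>sign_vecs (dim_col A). linf_norm (A *\<^sub>v x))"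

definition submatrices :: "real mat \<Rightarrow> real mat set" where
  "submatrices A = {submatrix A I J |I J.
     I \<noteq> {} \<and> I \<subseteq> {..<dim_row A} \<and> J \<noteq> {} \<and> J \<subseteq> {..<dim_col A}}"

definition herdisc :: "real mat \<Rightarrow> real" where
  "herdisc A = (MAX B\<in>submatrices A. disc B)"

definition detlb :: "real mat \<Rightarrow> real" where
  "detlb A = (MAX k\<in>{1..min (dim_row A) (dim_col A)}.
     MAX B\<in>submatrices A \<inter> carrier_mat k k. root k \<bar>det B\<bar>)"

lemma finite_sign_vecs: "finite (sign_vecs n)"
proof (rule finite_subset)
  show "sign_vecs n \<subseteq> vec_of_list ` {xs. set xs \<subseteq> {-1, 1} \<and> length xs = n}"
  proof
    fix x assume x: "x \<in> sign_vecs n"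
    have "set (list_of_vec x) \<subseteq> {-1, 1} \<and> length (list_of_vec x) = n"
      using x by (auto simp: sign_vecs_def set_list_of_vec vec_set_def)
    then show "x \<in> vec_of_list ` {xs. set xs \<subseteq> {-1, 1} \<and> length xs = n}"
      by (intro image_eqI[of _ _ "list_of_vec x"]) (auto simp: vec_list)
  qed
  show "finite (vec_of_list ` {xs :: real list. set xs \<subseteq> {-1, 1} \<and> length xs = n})"
    by (intro finite_imageI finite_lists_length_eq) simp
qed

lemma sign_vecs_nonempty: "sign_vecs n \<noteq> {}"
proof -
  have "vec n (\<lambda>_. 1) \<in> sign_vecs n"
    by (simp add: sign_vecs_def)
  then show ?thesis by blast
qed

lemma finite_submatrices: "finite (submatrices A)"
proof (rule finite_subset)
  show "submatrices A \<subseteq> (\<lambda>(I, J). submatrix A I J) ` (Pow {..<dim_row A} \<times> Pow {..<dim_col A})"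
    by (auto simp: submatrices_def)
qed simp

lemma submatrix_carrier:
  assumes "I \<subseteq> {..<dim_row A}" "J \<subseteq> {..<dim_col A}"
  shows "submatrix A I J \<in> carrier_mat (card I) (card J)"
proof -
  have "{i. i < dim_row A \<and> i \<in> I} = I" "{j. j < dim_col A \<and> j \<in> J} = J"
    using assms by auto
  then show ?thesis
    by (intro carrier_matI) (simp_all add: dim_submatrix)
qed

lemma square_submatrices_nonempty:
  assumes "k \<in> {1..min (dim_row A) (dim_col A)}"
  shows "submatrices A \<inter> carrier_mat k k \<noteq> {}"
proof -
  have "submatrix A {..<k} {..<k} \<in> carrier_mat (card {..<k}) (card {..<k})"
    using assms by (intro submatrix_carrier) auto
  moreover have "submatrix A {..<k} {..<k} \<in> submatrices A"
    using assms unfolding submatrices_def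
    by (intro CollectI exI[of _ "{..<k}"]) (auto simp: lessThan_empty_iff)
  ultimately show ?thesis by auto
qed

end

theory Submission
  imports Defs "HOL-Analysis.Convex"
begin

text \<open>
  Write \<open>D = detlb A\<close> and restrict \<open>A\<close> to a set \<open>S\<close> of \<open>k\<close> columns.  Apply Gram--Schmidt to rows of
  \<open>A\<close>, always picking a row at distance more than \<open>2 * D\<close> from the span of the previous ones.  If
  this gave \<open>d > k / 2\<close> rows, their Gram determinant would exceed \<open>(2 * D) ^ (2 * d)\<close>, whereas by
  Cauchy--Binet it is a sum of \<open>k choose d \<le> 4 ^ d\<close> squared minors, each at most \<open>D ^ (2 * d)\<close>.
  So all rows lie within \<open>2 * D\<close> of a space \<open>W\<close> of dimension at most \<open>k / 2\<close>.  A point of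
  \<open>[-1, 1]\<^sup>S\<close> can be moved orthogonally to \<open>W\<close> until at most \<open>k / 2\<close> coordinates differ from
  \<open>1\<close> and \<open>-1\<close>; the displacement has length at most \<open>2 * sqrt k\<close>, so it changes the inner product
  with every row by at most \<open>4 * D * sqrt k\<close>.  Repeating this on the remaining fractional
  coordinates, the errors form a geometric series with ratio \<open>1 / sqrt 2\<close>, whose sum is at most
  \<open>14 * D * sqrt n\<close>.
\<close>

section \<open>Minors and the determinant lower bound\<close>

lemma abs_det_permute_rows:
  fixes A :: "real mat"
  assumes "A \<in> carrier_mat n n" "p permutes {0..<n}"
  shows "\<bar>det (mat n n (\<lambda>(i, j). A $$ (p i, j)))\<bar> = \<bar>det A\<bar>"
  by (subst det_permute_rows[OF assms]) (auto simp: abs_mult sign_def)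

lemma abs_det_permute_cols:
  fixes A :: "real mat"
  assumes A: "A \<in> carrier_mat n n" and p: "p permutes {0..<n}"
  shows "\<bar>det (mat n n (\<lambda>(i, j). A $$ (i, p j)))\<bar> = \<bar>det A\<bar>"
proof -
  have "mat n n (\<lambda>(i, j). A $$ (i, p j))
      = transpose_mat (mat n n (\<lambda>(i, j). transpose_mat A $$ (p i, j)))"
    using A permutes_in_image[OF p] by (intro eq_matI) auto
  then have "\<bar>det (mat n n (\<lambda>(i, j). A $$ (i, p j)))\<bar>
      = \<bar>det (mat n n (\<lambda>(i, j). transpose_mat A $$ (p i, j)))\<bar>"
    by (simp add: det_transpose[of _ n])
  also have "\<dots> = \<bar>det (transpose_mat A)\<bar>"
    using A p by (intro abs_det_permute_rows) auto
  finally show ?thesis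
    using A by (simp add: det_transpose)
qed

lemma bij_betw_pick:
  assumes "finite I"
  shows "bij_betw (pick I) {0..<card I} I"
proof -
  have "inj_on (pick I) {0..<card I}"
    by (auto simp: inj_on_def) (metis nat_neq_iff pick_mono_le)
  moreover have "pick I ` {0..<card I} \<subseteq> I"
    using pick_in_set_le by auto
  ultimately show ?thesis
    using assms by (simp add: bij_betw_def card_image card_subset_eq)
qed

text \<open>\<open>submatrix\<close> always lists its indices in increasing order, through
  \<open>pick\<close>. An injective choice in any other order therefore differs from a submatrix
  choice only by a permutation of positions.\<close>

lemma inj_on_eq_pick_permutes:
  fixes f :: "nat \<Rightarrow> nat"
  assumes "inj_on f {0..<d}"
  obtains p where "p permutes {0..<d}" "\<And>i. i < d \<Longrightarrow> f i = pick (f ` {0..<d}) (p i)"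
proof -
  let ?I = "f ` {0..<d}"
  have card: "card ?I = d"
    using assms by (simp add: card_image)
  have b: "bij_betw (pick ?I) {0..<d} ?I"
    using bij_betw_pick[of ?I] card by simp
  define p where "p i = (if i < d then inv_into {0..<d} (pick ?I) (f i) else i)" for i
  have "bij_betw (inv_into {0..<d} (pick ?I) \<circ> f) {0..<d} {0..<d}"
    using assms by (intro bij_betw_trans[OF _ bij_betw_inv_into[OF b]]) (simp add: bij_betw_def)
  then have "bij_betw p {0..<d} {0..<d}"
    by (subst bij_betw_cong[of _ _ "inv_into {0..<d} (pick ?I) \<circ> f"]) (auto simp: p_def)
  then have "p permutes {0..<d}"
    by (rule bij_imp_permutes) (simp add: p_def)
  moreover have "f i = pick ?I (p i)" if "i < d" for i
    using that bij_betw_inv_into_right[OF b, of "f i"] by (simp add: p_def)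
  ultimately show ?thesis by (rule that)
qed

lemma detlb_ge:
  assumes "B \<in> submatrices A" "B \<in> carrier_mat k k" "k > 0" "k \<le> dim_row A" "k \<le> dim_col A"
  shows "root k \<bar>det B\<bar> \<le> detlb A"
proof -
  have "root k \<bar>det B\<bar> \<le> (MAX B\<in>submatrices A \<inter> carrier_mat k k. root k \<bar>det B\<bar>)"
    using assms finite_submatrices[of A] by (intro Max_ge) auto
  also have "\<dots> \<le> detlb A"
    unfolding detlb_def using assms by (intro Max_ge) auto
  finally show ?thesis .
qed

lemma detlb_nonneg:
  assumes "dim_row A > 0" "dim_col A > 0"
  shows "detlb A \<ge> 0"
proof -
  obtain B where "B \<in> submatrices A \<inter> carrier_mat 1 1"
    using square_submatrices_nonempty[of 1 A] assms by auto
  then have "root 1 \<bar>det B\<bar> \<le> detlb A"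
    using assms by (intro detlb_ge) auto
  then show ?thesis by (smt (verit) real_root_ge_zero)
qed

text \<open>A repeated index gives two equal rows or columns, hence determinant 0. Otherwise sorting
  the indices changes at most the sign and yields a member of \<open>submatrices A\<close>. For
  \<open>d = 0\<close> both sides are 1.\<close>

lemma abs_minor_le_detlb_power:
  assumes A: "dim_row A > 0" "dim_col A > 0"
    and f: "\<And>i. i < d \<Longrightarrow> f i < dim_row A" and g: "\<And>j. j < d \<Longrightarrow> g j < dim_col A"
  shows "\<bar>det (mat d d (\<lambda>(i, j). A $$ (f i, g j)))\<bar> \<le> detlb A ^ d"
proof -
  let ?M = "mat d d (\<lambda>(i, j). A $$ (f i, g j))"
  have D: "detlb A \<ge> 0" using detlb_nonneg[OF A] .
  consider "d = 0" | "\<not> inj_on f {0..<d}" | "\<not> inj_on g {0..<d}"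
    | "d > 0" "inj_on f {0..<d}" "inj_on g {0..<d}" by blast
  then show ?thesis
  proof cases
    case 2
    then obtain i j where "i < d" "j < d" "i \<noteq> j" "f i = f j" by (auto simp: inj_on_def)
    then have "det ?M = 0"
      by (intro det_identical_rows[of _ d i j]) auto
    then show ?thesis using D by simp
  next
    case 3
    then obtain i j where "i < d" "j < d" "i \<noteq> j" "g i = g j" by (auto simp: inj_on_def)
    then have "det ?M = 0"
      by (intro det_identical_columns[of _ d i j]) auto
    then show ?thesis using D by simp
  next
    case 4
    let ?I = "f ` {0..<d}" and ?J = "g ` {0..<d}"
    obtain p where p: "p permutes {0..<d}" "\<And>i. i < d \<Longrightarrow> f i = pick ?I (p i)"
      using inj_on_eq_pick_permutes[OF 4(2)] by blast
    obtain q where q: "q permutes {0..<d}" "\<And>i. i < d \<Longrightarrow> g i = pick ?J (q i)"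
      using inj_on_eq_pick_permutes[OF 4(3)] by blast
    have card: "card ?I = d" "card ?J = d"
      using 4 by (simp_all add: card_image)
    have sub: "?I \<subseteq> {..<dim_row A}" "?J \<subseteq> {..<dim_col A}"
      using f g by auto
    have le: "d \<le> dim_row A" "d \<le> dim_col A"
      using card_mono[OF _ sub(1)] card_mono[OF _ sub(2)] card by auto
    define B where "B = submatrix A ?I ?J"
    have B: "B \<in> carrier_mat d d"
      using submatrix_carrier[OF sub] card by (simp add: B_def)
    have sets: "{i. i < dim_row A \<and> i \<in> ?I} = ?I" "{j. j < dim_col A \<and> j \<in> ?J} = ?J"
      using sub by auto
    have entry: "B $$ (i, j) = A $$ (pick ?I i, pick ?J j)" if "i < d" "j < d" for i j
      unfolding B_def using that card sets by (intro submatrix_index) simp_all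
    \<comment> \<open>The inner matrix reorders the rows of \<open>B\<close> by \<open>p\<close>,
      the outer one then reorders its columns by \<open>q\<close>.\<close>
    have "?M = mat d d (\<lambda>(i, j). mat d d (\<lambda>(i, j). B $$ (p i, j)) $$ (i, q j))"
      using p q permutes_in_image[OF p(1)] permutes_in_image[OF q(1)]
      by (intro eq_matI) (auto simp: entry)
    then have "\<bar>det ?M\<bar> = \<bar>det B\<bar>"
      using abs_det_permute_cols[OF _ q(1), of "mat d d (\<lambda>(i, j). B $$ (p i, j))"]
        abs_det_permute_rows[OF B p(1)] by simp
    moreover have "B \<in> submatrices A"
      unfolding submatrices_def B_def
      by (intro CollectI exI[of _ ?I] exI[of _ ?J]) (use sub 4(1) in auto)
    then have "root d \<bar>det B\<bar> \<le> detlb A"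
      using detlb_ge B 4(1) le by blast
    then have "root d \<bar>det B\<bar> ^ d \<le> detlb A ^ d"
      using 4(1) by (intro power_mono) auto
    then have "\<bar>det B\<bar> \<le> detlb A ^ d"
      using 4(1) by simp
    ultimately show ?thesis by simp
  qed simp
qed

section \<open>Gram--Schmidt residuals\<close>

definition dot_on :: "'a set \<Rightarrow> ('a \<Rightarrow> real) \<Rightarrow> ('a \<Rightarrow> real) \<Rightarrow> real" where
  "dot_on S u v = (\<Sum>c\<in>S. u c * v c)"

text \<open>For pairwise orthogonal nonzero \<open>q l\<close> this is the component of
  \<open>v\<close> orthogonal to the first \<open>i\<close> of them. It is not normalised, so that
  passing from rows to residuals preserves determinants.\<close>

definition residual :: "'a set \<Rightarrow> (nat \<Rightarrow> 'a \<Rightarrow> real) \<Rightarrow> nat \<Rightarrow> ('a \<Rightarrow> real) \<Rightarrow> 'a \<Rightarrow> real" where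
  "residual S q i v = (\<lambda>c. v c - (\<Sum>l<i. dot_on S v (q l) / dot_on S (q l) (q l) * q l c))"

text \<open>Rows and columns are chosen by arbitrary functions, with repetitions and in any order.
  This fits sums over column sequences, and the bound passes at once to any subset of the
  columns.\<close>

definition minors_bounded :: "('r \<Rightarrow> 'a \<Rightarrow> real) \<Rightarrow> 'r set \<Rightarrow> 'a set \<Rightarrow> real \<Rightarrow> bool" where
  "minors_bounded a R S D \<longleftrightarrow> (\<forall>d. \<forall>f \<in> {..<d} \<rightarrow> R. \<forall>g \<in> {..<d} \<rightarrow> S.
    \<bar>det (mat d d (\<lambda>(i, j). a (f i) (g j)))\<bar> \<le> D ^ d)"

lemma dot_on_commute: "dot_on S u v = dot_on S v u"
  by (simp add: dot_on_def mult.commute)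

lemma dot_on_diff_left: "dot_on S (\<lambda>c. u c - v c) w = dot_on S u w - dot_on S v w"
  by (simp add: dot_on_def left_diff_distrib sum_subtractf)

lemma dot_on_sum_left: "dot_on S (\<lambda>c. \<Sum>l\<in>L. t l * q l c) w = (\<Sum>l\<in>L. t l * dot_on S (q l) w)"
  unfolding dot_on_def sum_distrib_right sum_distrib_left
  by (subst sum.swap) (simp add: mult.assoc)

lemma abs_dot_on_le: "\<bar>dot_on S u v\<bar> \<le> sqrt (dot_on S u u) * sqrt (dot_on S v v)"
proof -
  have "(dot_on S u v)\<^sup>2 \<le> dot_on S u u * dot_on S v v"
    using Cauchy_Schwarz_ineq_sum[of u v S] by (simp add: dot_on_def power2_eq_square)
  then show ?thesis
    by (metis real_sqrt_abs real_sqrt_le_mono real_sqrt_mult)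
qed

lemma dot_on_residual_eq_0:
  assumes "\<And>j l. j < i \<Longrightarrow> l < i \<Longrightarrow> j \<noteq> l \<Longrightarrow> dot_on S (q j) (q l) = 0"
    and "\<And>l. l < i \<Longrightarrow> dot_on S (q l) (q l) \<noteq> 0" and "l < i"
  shows "dot_on S (residual S q i v) (q l) = 0"
proof -
  have "(\<Sum>j<i. dot_on S v (q j) / dot_on S (q j) (q j) * dot_on S (q j) (q l))
      = (\<Sum>j<i. if j = l then dot_on S v (q l) else 0)"
    using assms by (intro sum.cong) auto
  then show ?thesis
    unfolding residual_def dot_on_diff_left dot_on_sum_left using assms(3) by simp
qed

section \<open>Determinants of residuals and Cauchy-Binet\<close>

text \<open>Each \<open>b j\<close> is \<open>q j\<close> plus a combination of earlier
  \<open>q l\<close>, so the matrix of the \<open>b j\<close> is a lower unitriangular matrix times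
  that of the \<open>q j\<close>.\<close>

lemma det_residuals:
  fixes q b :: "nat \<Rightarrow> 'a \<Rightarrow> real"
  assumes "\<And>j. j < d \<Longrightarrow> q j = residual S q j (b j)"
  shows "det (mat d d (\<lambda>(j, l). b j (g l))) = det (mat d d (\<lambda>(j, l). q j (g l)))"
proof -
  define t where "t j l = (if l < j then dot_on S (b j) (q l) / dot_on S (q l) (q l)
    else if l = j then 1 else 0)" for j l
  let ?T = "mat d d (\<lambda>(j, l). t j l)"
  let ?Q = "mat d d (\<lambda>(j, l). q j (g l))"
  have "b j c = (\<Sum>l\<in>{0..<d}. t j l * q l c)" if "j < d" for j c
  proof -
    have "(\<Sum>l\<in>{0..<d}. t j l * q l c) = (\<Sum>l\<in>{..<Suc j}. t j l * q l c)"
      using that by (intro sum.mono_neutral_right) (auto simp: t_def)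
    also have "\<dots> = q j c + (\<Sum>l<j. dot_on S (b j) (q l) / dot_on S (q l) (q l) * q l c)"
      by (simp add: t_def)
    also have "\<dots> = b j c"
      by (subst (1) assms[OF that]) (simp add: residual_def)
    finally show ?thesis by simp
  qed
  then have "mat d d (\<lambda>(j, l). b j (g l)) = ?T * ?Q"
    by (intro eq_matI) (auto simp: scalar_prod_def)
  moreover have "det ?T = 1"
    by (subst det_lower_triangular[of d]) (auto simp: t_def prod_list_diag_prod)
  ultimately show ?thesis
    by (simp add: det_mult[of _ d])
qed

text \<open>Cauchy--Binet for a diagonal Gram matrix; the factor \<open>fact d\<close> appears because the sum is over
  column sequences rather than column sets.\<close>

lemma sum_det_square_orthogonal:
  fixes q :: "nat \<Rightarrow> 'a \<Rightarrow> real"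
  assumes S: "finite S"
    and orth: "\<And>j l. j < d \<Longrightarrow> l < d \<Longrightarrow> j \<noteq> l \<Longrightarrow> dot_on S (q j) (q l) = 0"
  shows "(\<Sum>g\<in>{..<d} \<rightarrow>\<^sub>E S. (det (mat d d (\<lambda>(j, l). q j (g l))))\<^sup>2)
    = fact d * (\<Prod>j<d. dot_on S (q j) (q j))"
proof -
  let ?P = "{p. p permutes {0..<d}}"
  let ?G = "{..<d} \<rightarrow>\<^sub>E S"
  have "(det (mat d d (\<lambda>(j, l). q j (g l))))\<^sup>2
      = (\<Sum>p\<in>?P. \<Sum>p'\<in>?P. signof p * signof p' * (\<Prod>j<d. q (p j) (g j) * q (p' j) (g j)))"
    for g
  proof -
    have "det (mat d d (\<lambda>(j, l). q j (g l))) = (\<Sum>p\<in>?P. signof p * (\<Prod>j<d. q (p j) (g j)))"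
    proof (subst det_col[of _ d], simp, intro sum.cong refl arg_cong2[where f="(*)"] prod.cong)
      fix p j assume "p \<in> ?P" "j \<in> {..<d}"
      then show "mat d d (\<lambda>(j, l). q j (g l)) $$ (p j, j) = q (p j) (g j)"
        using permutes_in_image[of p "{0..<d}" j] by auto
    qed
    then show ?thesis
      by (simp add: power2_eq_square sum_product prod.distrib mult_ac)
  qed
  then have "(\<Sum>g\<in>?G. (det (mat d d (\<lambda>(j, l). q j (g l))))\<^sup>2)
      = (\<Sum>g\<in>?G. \<Sum>p\<in>?P. \<Sum>p'\<in>?P. signof p * signof p' * (\<Prod>j<d. q (p j) (g j) * q (p' j) (g j)))"
    by simp
  \<comment> \<open>With the sum over \<open>g\<close> innermost, it factors over the positions
    \<open>j\<close> into inner products.\<close>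
  also have "\<dots> = (\<Sum>p\<in>?P. \<Sum>p'\<in>?P. signof p * signof p'
      * (\<Sum>g\<in>?G. \<Prod>j<d. q (p j) (g j) * q (p' j) (g j)))"
    by (subst sum.swap, rule sum.cong[OF refl], subst sum.swap) (simp add: sum_distrib_left)
  also have "\<dots> = (\<Sum>p\<in>?P. \<Sum>p'\<in>?P. signof p * signof p'
      * (\<Prod>j<d. dot_on S (q (p j)) (q (p' j))))"
    unfolding dot_on_def using S by (subst prod_sum_PiE) auto
  \<comment> \<open>If \<open>p\<close> and \<open>p'\<close> differ at some \<open>j\<close>,
    orthogonality makes that factor 0. If they agree, the signs cancel and the product is merely
    reordered.\<close>
  also have "\<dots> = (\<Sum>p\<in>?P. \<Sum>p'\<in>?P. if p' = p then \<Prod>j<d. dot_on S (q j) (q j) else 0)"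
  proof (intro sum.cong refl)
    fix p p' assume p: "p \<in> ?P" and p': "p' \<in> ?P"
    show "signof p * signof p' * (\<Prod>j<d. dot_on S (q (p j)) (q (p' j)))
        = (if p' = p then \<Prod>j<d. dot_on S (q j) (q j) else 0)"
    proof (cases "p' = p")
      case True
      have "(\<Prod>j<d. dot_on S (q (p j)) (q (p j))) = (\<Prod>j<d. dot_on S (q j) (q j))"
        using p prod.permute[of p "{..<d}" "\<lambda>j. dot_on S (q j) (q j)"]
        by (simp add: atLeast0LessThan comp_def)
      then show ?thesis using True by (simp add: sign_def)
    next
      case False
      then obtain j where "p' j \<noteq> p j" by blast
      moreover have "j < d"
        using calculation p p' by (metis atLeast0LessThan lessThan_iff mem_Collect_eq permutes_not_in)
      moreover have "p j < d" "p' j < d"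
        using p p' permutes_in_image[of _ "{0..<d}" j] \<open>j < d\<close> by auto
      ultimately have "(\<Prod>j<d. dot_on S (q (p j)) (q (p' j))) = 0"
        using orth[of "p j" "p' j"] by (intro prod_zero) auto
      then show ?thesis using False by simp
    qed
  qed
  also have "\<dots> = fact d * (\<Prod>j<d. dot_on S (q j) (q j))"
    by (simp add: finite_permutations card_permutations[of _ d])
  finally show ?thesis .
qed

text \<open>The bound keeps \<open>fact d\<close> as a separate factor, to cancel the one in
  \<open>sum_det_square_orthogonal\<close>.\<close>

lemma card_inj_PiE_le:
  assumes S: "finite S" and d: "d \<le> card S"
  shows "card {g \<in> {..<d} \<rightarrow>\<^sub>E S. inj_on g {..<d}} \<le> (card S choose d) * fact d"
proof -
  let ?L = "{xs. length xs = d \<and> distinct xs \<and> set xs \<subseteq> S}"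
  have "card {g \<in> {..<d} \<rightarrow>\<^sub>E S. inj_on g {..<d}} \<le> card ?L"
  proof (rule card_inj_on_le[of "\<lambda>g. map g [0..<d]"])
    show "inj_on (\<lambda>g. map g [0..<d]) {g \<in> {..<d} \<rightarrow>\<^sub>E S. inj_on g {..<d}}"
    proof (rule inj_onI)
      fix g h assume "g \<in> {g \<in> {..<d} \<rightarrow>\<^sub>E S. inj_on g {..<d}}" "h \<in> {g \<in> {..<d} \<rightarrow>\<^sub>E S. inj_on g {..<d}}"
        and eq: "map g [0..<d] = map h [0..<d]"
      then have "g \<in> {..<d} \<rightarrow>\<^sub>E S" "h \<in> {..<d} \<rightarrow>\<^sub>E S" by simp_all
      then show "g = h"
      proof (rule PiE_ext)
        fix j assume "j \<in> {..<d}"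
        then show "g j = h j" using eq by simp
      qed
    qed
    show "(\<lambda>g. map g [0..<d]) ` {g \<in> {..<d} \<rightarrow>\<^sub>E S. inj_on g {..<d}} \<subseteq> ?L"
    proof (rule image_subsetI)
      fix g assume "g \<in> {g \<in> {..<d} \<rightarrow>\<^sub>E S. inj_on g {..<d}}"
      then have "g ` {..<d} \<subseteq> S" "inj_on g {..<d}" by auto
      then show "map g [0..<d] \<in> ?L" by (simp add: distinct_map atLeast0LessThan)
    qed
    show "finite ?L"
      using finite_lists_length_eq[OF S, of d] by (rule rev_finite_subset) auto
  qed
  also have "card ?L = \<Prod>{card S - d + 1..card S}"
    using S d by (rule card_lists_distinct_length_eq)
  also have "\<dots> = fact (card S) div fact (card S - d)"
    by (simp add: fact_div_fact)
  also have "\<dots> = (card S choose d) * fact d"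
    by (subst binomial_fact_lemma[OF d, symmetric]) (simp add: mult_ac)
  finally show ?thesis .
qed


section \<open>Greedy choice of rows with long residuals\<close>

lemma residual_cong:
  assumes "\<And>l. l < i \<Longrightarrow> q l = q' l"
  shows "residual S q i v = residual S q' i v"
  using assms by (simp add: residual_def)

text \<open>The conclusion is shaped for rounding: a residual differs from \<open>a r\<close> by a
  combination of the \<open>q l\<close> with \<open>l < i\<close>, so a displacement orthogonal to
  these has the same inner product with both.\<close>

lemma obtain_small_residuals:
  fixes a :: "'r \<Rightarrow> 'a \<Rightarrow> real"
  assumes S: "finite S" "S \<noteq> {}" and D: "D \<ge> 0"
    and minors: "minors_bounded a R S D"
  obtains q i where "i \<le> card S div 2"
    and "\<And>r. r \<in> R \<Longrightarrow> dot_on S (residual S q i (a r)) (residual S q i (a r)) \<le> (2 * D)\<^sup>2"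
proof (rule ccontr)
  assume "\<not> thesis"
  with that have long: "\<exists>r\<in>R. (2 * D)\<^sup>2 < dot_on S (residual S q i (a r)) (residual S q i (a r))"
    if "i \<le> card S div 2" for i q
    using \<open>i \<le> card S div 2\<close> by (meson not_less)
  \<comment> \<open>\<open>gs i f q\<close> describes a successful greedy run of length
    \<open>i\<close>: \<open>f\<close> names the chosen rows and \<open>q\<close> holds their long,
    pairwise orthogonal residuals.\<close>
  define gs where "gs i f q \<longleftrightarrow>
    (\<forall>j<i. f j \<in> R \<and> q j = residual S q j (a (f j)) \<and> (2 * D)\<^sup>2 < dot_on S (q j) (q j)) \<and>
    (\<forall>j<i. \<forall>l<i. j \<noteq> l \<longrightarrow> dot_on S (q j) (q l) = 0)" for i f q
  have "\<exists>f q. gs i f q" if "i \<le> Suc (card S div 2)" for i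
    using that
  proof (induction i)
    case 0
    then show ?case by (simp add: gs_def)
  next
    case (Suc i)
    then obtain f q where fq: "gs i f q" by auto
    from long[of i q] Suc.prems obtain r where r: "r \<in> R"
      "(2 * D)\<^sup>2 < dot_on S (residual S q i (a r)) (residual S q i (a r))" by auto
    define q' where "q' = q(i := residual S q i (a r))"
    have same: "residual S q' j v = residual S q j v" if "j \<le> i" for j v
      using that by (intro residual_cong) (simp add: q'_def)
    have f: "f j \<in> R" and q: "q j = residual S q j (a (f j))"
      and len: "(2 * D)\<^sup>2 < dot_on S (q j) (q j)" if "j < i" for j
      using fq that unfolding gs_def by blast+
    have orth_q: "dot_on S (q j) (q l) = 0" if "j < i" "l < i" "j \<noteq> l" for j l
      using fq that unfolding gs_def by blast
    \<comment> \<open>The strict inequality in \<open>len\<close> excludes zero vectors even when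
      \<open>D = 0\<close>.\<close>
    have "dot_on S (q l) (q l) \<noteq> 0" if "l < i" for l
      using len[OF that] by (metis zero_le_power2 not_less)
    then have "dot_on S (residual S q i (a r)) (q l) = 0" if "l < i" for l
      using orth_q that by (intro dot_on_residual_eq_0) auto
    then have orth: "dot_on S (residual S q i (a r)) (q l) = 0"
      "dot_on S (q l) (residual S q i (a r)) = 0" if "l < i" for l
      using that by (simp_all add: dot_on_commute)
    have "gs (Suc i) (f(i := r)) q'"
      unfolding gs_def
    proof (intro conjI allI impI)
      fix j assume j: "j < Suc i"
      show "(f(i := r)) j \<in> R"
        using j f r by (auto simp: less_Suc_eq)
      show "q' j = residual S q' j (a ((f(i := r)) j))"
        using j q[of j] same[of j] by (cases "j = i") (simp_all add: q'_def)
      show "(2 * D)\<^sup>2 < dot_on S (q' j) (q' j)"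
        using j len[of j] r by (cases "j = i") (simp_all add: q'_def)
      fix l assume "l < Suc i" "j \<noteq> l"
      then show "dot_on S (q' j) (q' l) = 0"
        using j orth orth_q by (auto simp: less_Suc_eq q'_def)
    qed
    then show ?case by blast
  qed
  then obtain f q where fq: "gs (Suc (card S div 2)) f q" by blast
  \<comment> \<open>One more than half of \<open>card S\<close>: small enough for
    \<open>d \<le> card S\<close>, as \<open>S\<close> is nonempty, and large enough for
    \<open>card S \<le> 2 * d\<close>, which bounds the binomial coefficient by
    \<open>2 ^ (2 * d)\<close>.\<close>
  define d where "d = Suc (card S div 2)"
  have inv: "f j \<in> R" "q j = residual S q j (a (f j))" "(2 * D)\<^sup>2 < dot_on S (q j) (q j)"
    "\<And>l. l < d \<Longrightarrow> j \<noteq> l \<Longrightarrow> dot_on S (q j) (q l) = 0" if "j < d" for j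
    using fq that unfolding gs_def d_def by blast+
  have d: "d > 0" "d \<le> card S" "card S \<le> 2 * d"
    using S card_gt_0_iff[of S] by (auto simp: d_def)
  let ?G = "{..<d} \<rightarrow>\<^sub>E S"
  let ?H = "{g \<in> ?G. inj_on g {..<d}}"
  let ?det = "\<lambda>g. det (mat d d (\<lambda>(j, l). q j (g l)))"
  have fin: "finite ?G"
    using S by (intro finite_PiE) auto
  have "fact d * ((2 * D)\<^sup>2) ^ d < fact d * (\<Prod>j<d. dot_on S (q j) (q j))"
  proof (rule mult_strict_left_mono)
    have "(\<Prod>j<d. (2 * D)\<^sup>2) < (\<Prod>j<d. dot_on S (q j) (q j))"
    proof (rule prod_mono_strict[of 0])
      fix j assume "j \<in> {..<d}"
      then have "(2 * D)\<^sup>2 < dot_on S (q j) (q j)" using inv(3) by simp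
      then show "0 \<le> (2 * D)\<^sup>2 \<and> (2 * D)\<^sup>2 \<le> dot_on S (q j) (q j)" "0 < dot_on S (q j) (q j)"
        using zero_le_power2[of "2 * D"] by linarith+
    qed (use inv(3) d(1) in auto)
    then show "((2 * D)\<^sup>2) ^ d < (\<Prod>j<d. dot_on S (q j) (q j))"
      by simp
  qed simp
  also have "\<dots> = (\<Sum>g\<in>?G. (?det g)\<^sup>2)"
    using S inv(4) by (intro sum_det_square_orthogonal[symmetric]) auto
  \<comment> \<open>A sequence that repeats a column has determinant 0.\<close>
  also have "\<dots> = (\<Sum>g\<in>?H. (?det g)\<^sup>2)"
  proof (intro sum.mono_neutral_right fin ballI)
    fix g assume "g \<in> ?G - ?H"
    then obtain j l where "j < d" "l < d" "j \<noteq> l" "g j = g l" by (auto simp: inj_on_def)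
    then have "?det g = 0"
      by (intro det_identical_columns[of _ d j l]) auto
    then show "(?det g)\<^sup>2 = 0" by simp
  qed auto
  also have "\<dots> \<le> (\<Sum>g\<in>?H. (D ^ d)\<^sup>2)"
  proof (rule sum_mono)
    fix g assume "g \<in> ?H"
    then have "f \<in> {..<d} \<rightarrow> R" "g \<in> {..<d} \<rightarrow> S"
      using inv(1) by auto
    then have "\<bar>det (mat d d (\<lambda>(j, l). a (f j) (g l)))\<bar> \<le> D ^ d"
      using minors unfolding minors_bounded_def by blast
    then have "\<bar>?det g\<bar> \<le> D ^ d"
      by (subst (asm) det_residuals[OF inv(2)]) auto
    then show "(?det g)\<^sup>2 \<le> (D ^ d)\<^sup>2"
      by (simp add: abs_le_square_iff[symmetric])
  qed
  also have "\<dots> = real (card ?H) * (D ^ d)\<^sup>2"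
    by simp
  also have "\<dots> \<le> (2 ^ (2 * d) * fact d) * (D ^ d)\<^sup>2"
  proof (rule mult_right_mono)
    have "card ?H \<le> (card S choose d) * fact d"
      using S d by (intro card_inj_PiE_le) auto
    also have "\<dots> \<le> 2 ^ (2 * d) * fact d"
      using order_trans[OF binomial_le_pow2[of "card S" d] power_increasing[OF d(3), of "2::nat"]]
      by (intro mult_right_mono) auto
    finally have "real (card ?H) \<le> real (2 ^ (2 * d) * fact d)"
      by (rule of_nat_mono)
    then show "real (card ?H) \<le> 2 ^ (2 * d) * fact d"
      by simp
  qed simp
  \<comment> \<open>The threshold \<open>2 * D\<close> was chosen so that its square absorbs the
    factor 4 per row from the binomial bound. The chain thus closes on its starting value, although
    its first step is strict.\<close>
  also have "\<dots> = fact d * ((2 * D)\<^sup>2) ^ d"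
    by (simp add: power_mult_distrib mult_ac flip: power_mult) (simp add: power_mult mult.commute[of d])
  finally show False by simp
qed

section \<open>Rounding\<close>

text \<open>A homogeneous system with more unknowns than equations has a nonzero solution; the
  induction is Gaussian elimination on the last equation.\<close>

lemma obtain_orthogonal_vector:
  fixes q :: "nat \<Rightarrow> 'a \<Rightarrow> real"
  assumes "finite F" "i < card F"
  obtains v c where "c \<in> F" "v c \<noteq> 0" "\<And>c. c \<notin> F \<Longrightarrow> v c = 0"
    and "\<And>l. l < i \<Longrightarrow> dot_on F v (q l) = 0"
proof -
  have "\<exists>v. (\<exists>c\<in>F. v c \<noteq> 0) \<and> (\<forall>c. c \<notin> F \<longrightarrow> v c = 0) \<and> (\<forall>l<i. dot_on F v (q l) = 0)"
    using assms
  proof (induction i arbitrary: F q)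
    case 0
    then obtain c where "c \<in> F" by fastforce
    then show ?case
      by (intro exI[of _ "\<lambda>x. if x = c then 1 else 0"]) auto
  next
    case (Suc i)
    show ?case
    proof (cases "\<forall>c\<in>F. q i c = 0")
      case True
      obtain v where "(\<exists>c\<in>F. v c \<noteq> 0) \<and> (\<forall>c. c \<notin> F \<longrightarrow> v c = 0) \<and> (\<forall>l<i. dot_on F v (q l) = 0)"
        using Suc.IH[of F q] Suc.prems by auto
      then show ?thesis using True
        by (intro exI[of _ v]) (auto simp: less_Suc_eq dot_on_def)
    next
      case False
      then obtain c0 where c0: "c0 \<in> F" "q i c0 \<noteq> 0" by blast
      let ?F = "F - {c0}"
      \<comment> \<open>Subtracting a multiple of equation \<open>i\<close> removes the unknown
        \<open>c0\<close> from the other equations.\<close>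
      define q' where "q' l c = q l c - q l c0 / q i c0 * q i c" for l c
      obtain v where v: "\<exists>c\<in>?F. v c \<noteq> 0" "\<And>c. c \<notin> ?F \<Longrightarrow> v c = 0"
        "\<And>l. l < i \<Longrightarrow> dot_on ?F v (q' l) = 0"
      proof -
        have "i < card ?F" "finite ?F" using Suc.prems c0 by auto
        from Suc.IH[OF this(2,1), of q'] that show thesis by blast
      qed
      \<comment> \<open>This is equation \<open>i\<close> solved for the coordinate at
        \<open>c0\<close>.\<close>
      define t where "t = - dot_on ?F v (q i) / q i c0"
      define w where "w = v(c0 := t)"
      have split: "dot_on F w u = t * u c0 + dot_on ?F v u" for u
        using c0 Suc.prems(1) unfolding dot_on_def w_def
        by (subst sum.remove[of F c0]) (auto intro!: sum.cong)
      have "dot_on F w (q l) = 0" if "l < Suc i" for l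
      proof (cases "l = i")
        case True
        then show ?thesis using c0 by (simp add: split t_def)
      next
        case False
        then have "0 = dot_on ?F v (q' l)" using v(3) that by simp
        also have "\<dots> = dot_on ?F v (q l) - q l c0 / q i c0 * dot_on ?F v (q i)"
          by (simp add: dot_on_def q'_def right_diff_distrib sum_subtractf sum_distrib_left mult_ac)
        finally show ?thesis using c0 by (simp add: split t_def)
      qed
      moreover have "\<exists>c\<in>F. w c \<noteq> 0" using v(1) by (auto simp: w_def)
      moreover have "\<forall>c. c \<notin> F \<longrightarrow> w c = 0" using v(2) c0 by (auto simp: w_def)
      ultimately show ?thesis by blast
    qed
  qed
  then show ?thesis using that by blast
qed

lemma obtain_boundary_point:
  fixes x v :: "'a \<Rightarrow> real"
  assumes F: "finite F" "c0 \<in> F" "v c0 \<noteq> 0" and x: "\<And>c. c \<in> F \<Longrightarrow> \<bar>x c\<bar> < 1"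
  obtains t c where "c \<in> F" "\<bar>x c + t * v c\<bar> = 1" "\<And>c. c \<in> F \<Longrightarrow> \<bar>x c + t * v c\<bar> \<le> 1"
proof -
  let ?E = "{c \<in> F. v c \<noteq> 0}"
  \<comment> \<open>\<open>\<tau> c\<close> is the time at which coordinate \<open>c\<close>, moving
    with velocity \<open>v c\<close>, reaches the endpoint \<open>sgn (v c)\<close>. The minimum
    over the moving coordinates is the first such hit.\<close>
  define \<tau> where "\<tau> c = (1 - sgn (v c) * x c) / \<bar>v c\<bar>" for c
  define t where "t = Min (\<tau> ` ?E)"
  have E: "finite ?E" "?E \<noteq> {}" using F by auto
  have "t \<in> \<tau> ` ?E" unfolding t_def using E by (intro Min_in) auto
  then obtain c where c: "c \<in> F" "v c \<noteq> 0" "t = \<tau> c" by auto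
  have "\<bar>sgn (v e) * x e\<bar> < 1" if "e \<in> F" for e
    using x[OF that] by (auto simp: abs_mult sgn_if)
  \<comment> \<open>Moving forward in time means that no coordinate can cross the endpoint behind
    it.\<close>
  then have t: "t \<ge> 0"
    using c by (auto simp: \<tau>_def abs_less_iff less_imp_le)
  have "x c + t * v c = sgn (v c)"
    using c by (cases "v c > 0") (simp_all add: \<tau>_def)
  then have "\<bar>x c + t * v c\<bar> = 1"
    using c by (simp add: sgn_if)
  moreover have "\<bar>x e + t * v e\<bar> \<le> 1" if e: "e \<in> F" for e
  proof (cases "v e = 0")
    case True
    then show ?thesis using x[OF e] by simp
  next
    case False
    then have "t \<le> \<tau> e" unfolding t_def using E e by (intro Min_le) auto
    then have *: "t * \<bar>v e\<bar> \<le> 1 - sgn (v e) * x e"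
      using False by (simp add: \<tau>_def field_simps)
    have "0 \<le> t * \<bar>v e\<bar>" using t by simp
    then show ?thesis using * x[OF e] False
      by (cases "v e > 0") (auto simp: sgn_if abs_if split: if_splits)
  qed
  ultimately show ?thesis using that c by blast
qed

text \<open>While more than \<open>i\<close> coordinates are fractional, some direction supported on
  them is orthogonal to all \<open>q l\<close>. Following it to the boundary of the cube fixes a
  further coordinate and keeps the inner products.\<close>

lemma obtain_partial_rounding:
  fixes x :: "'a \<Rightarrow> real"
  assumes "finite S" "\<And>c. c \<in> S \<Longrightarrow> \<bar>x c\<bar> \<le> 1"
  obtains y where "\<And>c. c \<in> S \<Longrightarrow> \<bar>y c\<bar> \<le> 1" "card {c \<in> S. \<bar>y c\<bar> < 1} \<le> i"
    and "\<And>l. l < i \<Longrightarrow> dot_on S y (q l) = dot_on S x (q l)"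
proof -
  have "\<exists>y. (\<forall>c\<in>S. \<bar>y c\<bar> \<le> 1) \<and> card {c \<in> S. \<bar>y c\<bar> < 1} \<le> i
      \<and> (\<forall>l<i. dot_on S y (q l) = dot_on S x (q l))"
    using assms(2)
  proof (induction "card {c \<in> S. \<bar>x c\<bar> < 1}" arbitrary: x rule: less_induct)
    case less
    let ?F = "{c \<in> S. \<bar>x c\<bar> < 1}"
    show ?case
    proof (cases "card ?F \<le> i")
      case True
      then show ?thesis using less.prems by blast
    next
      case False
      have fin: "finite ?F" using assms(1) by simp
      have "i < card ?F" using False by simp
      then obtain v c0 where v: "c0 \<in> ?F" "v c0 \<noteq> 0" "\<And>c. c \<notin> ?F \<Longrightarrow> v c = 0"
        "\<And>l. l < i \<Longrightarrow> dot_on ?F v (q l) = 0"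
        by (rule obtain_orthogonal_vector[OF fin, of i q]) (rule that)
      obtain t c where t: "c \<in> ?F" "\<bar>x c + t * v c\<bar> = 1"
        "\<And>c. c \<in> ?F \<Longrightarrow> \<bar>x c + t * v c\<bar> \<le> 1"
        by (rule obtain_boundary_point[where F = ?F and v = v and x = x, OF fin v(1,2)])
          (simp, rule that)
      define y where "y c = x c + t * v c" for c
      have y: "\<bar>y c\<bar> \<le> 1" if "c \<in> S" for c
        using t(3)[of c] v(3)[of c] less.prems[OF that] by (cases "c \<in> ?F") (auto simp: y_def)
      \<comment> \<open>Coordinates already at 1 or -1 stay there because \<open>v\<close> vanishes
        on them, and \<open>c\<close> joins them.\<close>
      have "{c \<in> S. \<bar>y c\<bar> < 1} \<subseteq> ?F - {c}"
        using t(2) v(3) by (force simp: y_def)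
      then have "card {c \<in> S. \<bar>y c\<bar> < 1} < card ?F"
        using fin t(1) by (intro psubset_card_mono) auto
      then obtain z where z: "\<forall>c\<in>S. \<bar>z c\<bar> \<le> 1" "card {c \<in> S. \<bar>z c\<bar> < 1} \<le> i"
        "\<forall>l<i. dot_on S z (q l) = dot_on S y (q l)"
        using less.hyps[of y] y by blast
      have "dot_on S y (q l) = dot_on S x (q l)" if "l < i" for l
      proof -
        have "dot_on S v (q l) = dot_on ?F v (q l)"
          unfolding dot_on_def using assms(1) v(3) by (intro sum.mono_neutral_right) auto
        then show ?thesis using v(4)[OF that]
          by (simp add: dot_on_def y_def distrib_right sum.distrib mult.assoc flip: sum_distrib_left)
      qed
      then show ?thesis using z by auto
    qed
  qed
  then show ?thesis using that by blast
qed

section \<open>Iterated halving of the fractional coordinates\<close>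

text \<open>Since 1/2 is at most 25/49, halving the count shrinks the square root by a factor of at
  most 5/7. The constant 14 solves 4 + 14 * 5/7 = 14.\<close>

lemma halving_step_le:
  fixes k :: nat
  assumes "j \<le> k div 2"
  shows "4 * sqrt (real k) + 14 * sqrt (real j) \<le> 14 * sqrt (real k)"
proof -
  have "sqrt (real j) \<le> sqrt ((5 / 7)\<^sup>2 * real k)"
    using assms by (intro real_sqrt_le_mono) (auto simp: power2_eq_square)
  also have "\<dots> = 5 / 7 * sqrt (real k)"
    by (simp add: real_sqrt_mult)
  finally show ?thesis by simp
qed

text \<open>The starting point \<open>x\<close> is arbitrary because the recursive call starts from
  the fractional values left by the first partial rounding. Bounding \<open>y - x\<close> makes the
  errors of successive rounds add up.\<close>

lemma rounding_exists:
  fixes a :: "'r \<Rightarrow> 'a \<Rightarrow> real"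
  assumes "finite S" and D: "D \<ge> 0"
    and minors: "minors_bounded a R S D"
    and "\<And>c. c \<in> S \<Longrightarrow> \<bar>x c\<bar> \<le> 1"
  shows "\<exists>y. (\<forall>c\<in>S. \<bar>y c\<bar> = 1) \<and>
    (\<forall>r\<in>R. \<bar>dot_on S (\<lambda>c. y c - x c) (a r)\<bar> \<le> 14 * D * sqrt (real (card S)))"
  using assms(1) minors assms(4)
proof (induction "card S" arbitrary: S x rule: less_induct)
  case less
  show ?case
  proof (cases "S = {}")
    case True
    then show ?thesis by (simp add: dot_on_def)
  next
    case False
    obtain q i where i: "i \<le> card S div 2"
      and q: "\<And>r. r \<in> R \<Longrightarrow> dot_on S (residual S q i (a r)) (residual S q i (a r)) \<le> (2 * D)\<^sup>2"
      using obtain_small_residuals[OF less.prems(1) False D less.prems(2)] by blast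
    obtain y where y: "\<And>c. c \<in> S \<Longrightarrow> \<bar>y c\<bar> \<le> 1" "card {c \<in> S. \<bar>y c\<bar> < 1} \<le> i"
      "\<And>l. l < i \<Longrightarrow> dot_on S y (q l) = dot_on S x (q l)"
      using obtain_partial_rounding[OF less.prems(1), of x i q] less.prems(3) by blast
    define F where "F = {c \<in> S. \<bar>y c\<bar> < 1}"
    have F: "F \<subseteq> S" "finite F" "card F \<le> card S div 2"
      using y(2) i less.prems(1) by (auto simp: F_def)
    have "card S > 0" using False less.prems(1) by (simp add: card_gt_0_iff)
    then have "card F < card S" using F(3) by linarith
    obtain z where z: "\<forall>c\<in>F. \<bar>z c\<bar> = 1"
      "\<forall>r\<in>R. \<bar>dot_on F (\<lambda>c. z c - y c) (a r)\<bar> \<le> 14 * D * sqrt (real (card F))"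
    proof -
      have "minors_bounded a R F D"
        using less.prems(2) F(1) unfolding minors_bounded_def by blast
      with less.hyps[OF \<open>card F < card S\<close> F(2), of y] y(1) F(1) that show thesis by blast
    qed
    define w where "w c = (if c \<in> F then z c else y c)" for c
    have "\<bar>w c\<bar> = 1" if "c \<in> S" for c
      using z(1) y(1)[OF that] that by (auto simp: w_def F_def)
    moreover have "\<bar>dot_on S (\<lambda>c. w c - x c) (a r)\<bar> \<le> 14 * D * sqrt (real (card S))"
      if r: "r \<in> R" for r
    proof -
      let ?u = "\<lambda>c. y c - x c"
      let ?p = "residual S q i (a r)"
      \<comment> \<open>The displacement \<open>?u\<close> is orthogonal to every
        \<open>q l\<close>, so a row may be replaced by its short residual before applying
        Cauchy-Schwarz.\<close>
      have "dot_on S (q l) ?u = 0" if "l < i" for l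
        unfolding dot_on_commute[of S "q l"] dot_on_diff_left using y(3)[OF that] by simp
      then have "dot_on S ?p ?u = dot_on S (a r) ?u"
        unfolding residual_def dot_on_diff_left dot_on_sum_left by simp
      then have "\<bar>dot_on S ?u (a r)\<bar> \<le> sqrt (dot_on S ?p ?p) * sqrt (dot_on S ?u ?u)"
        using abs_dot_on_le[of S ?p ?u] by (simp add: dot_on_commute)
      also have "\<dots> \<le> 2 * D * (2 * sqrt (real (card S)))"
      proof (rule mult_mono)
        show "sqrt (dot_on S ?p ?p) \<le> 2 * D"
          using q[OF r] D by (simp add: real_le_lsqrt)
        have "dot_on S ?u ?u \<le> (\<Sum>c\<in>S. 4)"
          unfolding dot_on_def
        proof (rule sum_mono)
          fix c assume "c \<in> S"
          then have "\<bar>?u c\<bar> \<le> 2"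
            using y(1)[of c] less.prems(3)[of c] by linarith
          then show "?u c * ?u c \<le> 4"
            using abs_le_square_iff[of "?u c" 2] by (simp add: power2_eq_square)
        qed
        then have "sqrt (dot_on S ?u ?u) \<le> sqrt (4 * real (card S))"
          by (intro real_sqrt_le_mono) simp
        then show "sqrt (dot_on S ?u ?u) \<le> 2 * sqrt (real (card S))"
          by (simp add: real_sqrt_mult)
      qed (use D in \<open>auto simp: dot_on_def sum_nonneg\<close>)
      finally have 1: "\<bar>dot_on S ?u (a r)\<bar> \<le> 4 * D * sqrt (real (card S))" by simp
      have 2: "\<bar>dot_on F (\<lambda>c. z c - y c) (a r)\<bar> \<le> 14 * D * sqrt (real (card F))"
        using z(2) r by blast
      \<comment> \<open>The second round changes only coordinates in \<open>F\<close>, so the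
        induction hypothesis on \<open>F\<close> controls its error on all of
        \<open>S\<close>.\<close>
      have "dot_on S (\<lambda>c. w c - y c) (a r) = dot_on F (\<lambda>c. z c - y c) (a r)"
        unfolding dot_on_def using F(1) less.prems(1)
        by (intro sum.mono_neutral_cong_right) (auto simp: w_def)
      moreover have "dot_on S (\<lambda>c. w c - x c) (a r)
          = dot_on S ?u (a r) + dot_on S (\<lambda>c. w c - y c) (a r)"
        by (simp add: dot_on_diff_left)
      ultimately have "\<bar>dot_on S (\<lambda>c. w c - x c) (a r)\<bar>
          \<le> 4 * D * sqrt (real (card S)) + 14 * D * sqrt (real (card F))"
        using 1 2 by linarith
      also have "\<dots> = D * (4 * sqrt (real (card S)) + 14 * sqrt (real (card F)))"
        by (simp add: algebra_simps)
      also have "\<dots> \<le> D * (14 * sqrt (real (card S)))"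
        using halving_step_le[OF F(3)] D by (rule mult_left_mono)
      finally show ?thesis by (simp add: mult_ac)
    qed
    ultimately show ?thesis by blast
  qed
qed

section \<open>From roundings to discrepancy\<close>

lemma disc_submatrix_le:
  assumes A: "dim_row A > 0" "dim_col A > 0"
    and I: "I \<noteq> {}" "I \<subseteq> {..<dim_row A}" and J: "J \<noteq> {}" "J \<subseteq> {..<dim_col A}"
  shows "disc (submatrix A I J) \<le> 14 * sqrt (real (dim_col A)) * detlb A"
proof -
  let ?B = "submatrix A I J"
  have D: "detlb A \<ge> 0" using detlb_nonneg[OF A] .
  have fin: "finite I" "finite J" using I J finite_subset by blast+
  have B: "?B \<in> carrier_mat (card I) (card J)" using submatrix_carrier I J by blast
  have sets: "{i. i < dim_row A \<and> i \<in> I} = I" "{j. j < dim_col A \<and> j \<in> J} = J"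
    using I J by auto
  have minors: "minors_bounded (\<lambda>r c. A $$ (r, c)) I J (detlb A)"
    unfolding minors_bounded_def
    using I(2) J(2) by (intro allI ballI abs_minor_le_detlb_power A) auto
  \<comment> \<open>Starting from the origin, the displacement is the sign assignment
    itself.\<close>
  obtain y where y: "\<forall>c\<in>J. \<bar>y c\<bar> = 1"
    "\<forall>r\<in>I. \<bar>dot_on J y (\<lambda>c. A $$ (r, c))\<bar> \<le> 14 * detlb A * sqrt (real (card J))"
    using rounding_exists[OF fin(2) D minors, of "\<lambda>_. 0"] by auto
  \<comment> \<open>\<open>y\<close> is indexed by columns of \<open>A\<close>, while the submatrix
    numbers its columns from 0; \<open>pick J\<close> translates.\<close>
  define x where "x = vec (card J) (\<lambda>j. y (pick J j))"
  have "x \<in> sign_vecs (card J)"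
    using y(1) pick_in_set_le[of _ J] by (force simp: x_def sign_vecs_def abs_if split: if_splits)
  then have "disc ?B \<le> linf_norm (?B *\<^sub>v x)"
    unfolding disc_def using B finite_sign_vecs by (intro Min_le) auto
  also have "\<dots> \<le> 14 * detlb A * sqrt (real (card J))"
    unfolding linf_norm_def
  proof (rule Max.boundedI)
    show "(\<lambda>i. \<bar>(?B *\<^sub>v x) $ i\<bar>) ` {..<dim_vec (?B *\<^sub>v x)} \<noteq> {}"
      using B I fin by (auto simp: lessThan_empty_iff)
    fix s assume "s \<in> (\<lambda>i. \<bar>(?B *\<^sub>v x) $ i\<bar>) ` {..<dim_vec (?B *\<^sub>v x)}"
    then obtain i where i: "i < card I" and s: "s = \<bar>(?B *\<^sub>v x) $ i\<bar>" using B by auto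
    have "(?B *\<^sub>v x) $ i = (\<Sum>j\<in>{0..<card J}. A $$ (pick I i, pick J j) * y (pick J j))"
      using B i sets by (auto simp: scalar_prod_def x_def submatrix_index intro!: sum.cong)
    also have "\<dots> = dot_on J y (\<lambda>c. A $$ (pick I i, c))"
      unfolding dot_on_def
      by (subst sum.reindex_bij_betw[OF bij_betw_pick[OF fin(2)], symmetric]) (simp add: mult.commute)
    finally show "s \<le> 14 * detlb A * sqrt (real (card J))"
      using y(2) pick_in_set_le[OF i] s by simp
  qed simp
  also have "\<dots> \<le> 14 * detlb A * sqrt (real (dim_col A))"
    using D card_mono[OF _ J(2)] by (intro mult_left_mono real_sqrt_le_mono) auto
  finally show ?thesis by (simp add: mult_ac)
qed

theorem theorem2:
  shows "\<exists>C::real. C > 0 \<and>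
    (\<forall>m n. \<forall>A \<in> carrier_mat m n. m > 0 \<longrightarrow> n > 0 \<longrightarrow>
      herdisc A \<le> C * sqrt (real n) * detlb A)"
proof (intro exI[of _ 14] conjI allI ballI impI)
  fix m n and A :: "real mat"
  assume A: "A \<in> carrier_mat m n" "m > 0" "n > 0"
  have "submatrices A \<noteq> {}"
    using square_submatrices_nonempty[of 1 A] A by auto
  moreover have "disc B \<le> 14 * sqrt (real n) * detlb A" if "B \<in> submatrices A" for B
    using that disc_submatrix_le[of A] A by (auto simp: submatrices_def)
  ultimately show "herdisc A \<le> 14 * sqrt (real n) * detlb A"
    unfolding herdisc_def using finite_submatrices by (intro Max.boundedI) auto
qed simp

end
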